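(* Let $I$ be a bounded open interval, let $N$ be a nonnegative integer, let $a_n(x) \in C^{n}(I)$ for $n=0,1,\dots,N$, and let $r(x)$ be a given function on $I$. For $n=0,1,\dots,N$ define $$b_{n}(x)=\sum_{s=n}^N (-1)^{s-n}\binom{s}{n}\frac{d^{s-n}a_{s}(x)}{d x^{s-n}}.$$ Then the linear ordinary differential equation $$\sum_{n=0}^N a_{n}(x)\frac{d^{n}u(x)}{d x^n}=r(x), \quad x \in I,$$ can be rewritten in the form $$\sum_{n=0}^N \frac{d^{n}\left(b_{n}(x)u(x)\right)}{d x^n}=r(x), \quad x \in I;$$ that is, for every $u \in C^N(I)$ the left-hand sides of the two equations coincide on $I$.
   Context: Functions are real-valued, and $C^n(I)$ denotes the $n$ times continuously differentiable functions on the open interval $I$. The $0$th-order derivative of any $g \in C(I)$ is defined as the function itself: $\frac{d^0 g(x)}{dx^0} := g(x)$. *)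

theory Defs
  imports "HOL-Analysis.Analysis"
begin

text \<open>
  Functions on an open set \<open>I\<close> are represented by total functions of which only the values
  on \<open>I\<close> matter: \<open>(deriv ^^ k) f x\<close> at a point \<open>x\<close> of \<open>I\<close> depends only on \<open>f\<close> near \<open>x\<close>.
  Since \<open>deriv\<close> returns an unspecified value where a function is not differentiable,
  the class \<open>C\<^sup>n(I)\<close> demands differentiability of the derivatives of order below \<open>n\<close>
  explicitly; their continuity follows. For \<open>n = 0\<close> only continuity of \<open>f\<close> is required.
\<close>

definition Cn_on :: "nat \<Rightarrow> real set \<Rightarrow> (real \<Rightarrow> real) set" where
  "Cn_on n I = {f. (\<forall>k<n. \<forall>x\<in>I. (deriv ^^ k) f field_differentiable (at x)) \<and>
                   continuous_on I ((deriv ^^ n) f)}"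

definition bcoeff :: "nat \<Rightarrow> (nat \<Rightarrow> real \<Rightarrow> real) \<Rightarrow> nat \<Rightarrow> real \<Rightarrow> real" where
  "bcoeff N a n x =
     (\<Sum>s=n..N. (- 1) ^ (s - n) * real (s choose n) * (deriv ^^ (s - n)) (a s) x)"

end

theory Submission
  imports Defs
begin

text \<open>
  Both sides are linear in the coefficients \<open>a s\<close>, so after exchanging the order of summation
  it suffices to treat one coefficient \<open>f\<close> of class \<open>C\<^sup>s\<close> and to prove the inverse Leibniz formula
  \[ f\,u^{(s)} = \sum_{n=0}^{s} (-1)^{s-n} {s \choose n} \bigl(f^{(s-n)}\, u\bigr)^{(n)} . \]
  In terms of operators, let \<open>M f\<close> be multiplication by \<open>f\<close> and \<open>D\<close> differentiation. The product
  rule \<open>M f D = D M f - M f'\<close> says that moving \<open>D\<close> to the left of \<open>M f\<close> is the difference of the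
  two commuting operations ``compose with \<open>D\<close> on the left'' and ``differentiate the symbol''.
  The formula is the binomial theorem for the \<open>s\<close>-th power of that difference. It is proved in
  \<open>inverse_Leibniz\<close> by induction on \<open>s\<close>: Pascal's rule splits the sum into the formula for the
  pair \<open>(f', u)\<close> and the derivative of the formula for the pair \<open>(f, u)\<close>.

  What remains is regularity. The term \<open>f\<^bsup>(s-n)\<^esup> u\<close> is only of class \<open>C\<^sup>n\<close>, which is just enough
  for the \<open>n\<close> derivatives applied to it, and linearity of iterated derivatives may be used only
  for functions known to be that smooth. The closure properties of the classes \<open>C\<^sup>n\<close> supply this.
\<close>

section \<open>The classes of n times continuously differentiable functions\<close>

lemma Cn_on_0: "f \<in> Cn_on 0 I \<longleftrightarrow> continuous_on I f"
  by (simp add: Cn_on_def)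

text \<open>
  Peeling off the innermost derivative instead of the outermost one gives the recursion on which
  all the inductions on the order of smoothness below are based.
\<close>

lemma Cn_on_Suc:
  "f \<in> Cn_on (Suc n) I \<longleftrightarrow> (\<forall>x\<in>I. f field_differentiable (at x)) \<and> deriv f \<in> Cn_on n I"
  unfolding Cn_on_def by (auto simp: All_less_Suc2 funpow_Suc_right simp del: funpow.simps)

lemma Cn_on_Suc_imp_Cn_on:
  assumes "f \<in> Cn_on (Suc n) I"
  shows "f \<in> Cn_on n I"
  using assms
proof (induction n arbitrary: f)
  case 0
  then show ?case
    by (auto simp: Cn_on_Suc Cn_on_0
        intro!: continuous_at_imp_continuous_on field_differentiable_imp_continuous_at)
next
  case (Suc n)
  then show ?case by (metis Cn_on_Suc)
qed

lemma Cn_on_antimono: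
  assumes "f \<in> Cn_on n I" and "m \<le> n"
  shows "f \<in> Cn_on m I"
  using assms(2,1) by (induction rule: dec_induct) (auto intro: Cn_on_Suc_imp_Cn_on)

lemma funpow_deriv_Cn_on:
  assumes "f \<in> Cn_on (m + n) I"
  shows "(deriv ^^ m) f \<in> Cn_on n I"
  using assms
  by (induction m arbitrary: f) (auto simp: Cn_on_Suc funpow_Suc_right simp del: funpow.simps)

text \<open>
  A derivative at a point only depends on the germ of the function there. Hence functions
  may be replaced by others that agree with them on an open set \<open>I\<close>, whatever happens outside it.
\<close>

lemma deriv_cong_open:
  fixes f g :: "real \<Rightarrow> real"
  assumes "open I" and "\<And>x. x \<in> I \<Longrightarrow> f x = g x" and "x \<in> I"
  shows "deriv f x = deriv g x"
  using assms by (intro deriv_cong_ev) (auto simp: eventually_nhds)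

lemma funpow_deriv_cong_open:
  fixes f g :: "real \<Rightarrow> real"
  assumes "open I" and "\<And>x. x \<in> I \<Longrightarrow> f x = g x" and "x \<in> I"
  shows "(deriv ^^ n) f x = (deriv ^^ n) g x"
  using assms(3)
proof (induction n arbitrary: x)
  case (Suc n)
  then show ?case using deriv_cong_open[OF assms(1), of "(deriv ^^ n) f" "(deriv ^^ n) g"] by simp
qed (simp add: assms)

lemma field_differentiable_cong_open:
  fixes f g :: "real \<Rightarrow> real"
  assumes "open I" and "\<And>x. x \<in> I \<Longrightarrow> f x = g x" and "x \<in> I"
    and "f field_differentiable (at x)"
  shows "g field_differentiable (at x)"
  using assms unfolding field_differentiable_def
  by (metis has_field_derivative_transform_within_open)

lemma Cn_on_cong:
  assumes "open I" and "\<And>x. x \<in> I \<Longrightarrow> f x = g x" and "f \<in> Cn_on n I"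
  shows "g \<in> Cn_on n I"
proof -
  have eq: "(deriv ^^ k) f x = (deriv ^^ k) g x" if "x \<in> I" for k x
    using assms(1,2) that by (rule funpow_deriv_cong_open)
  have "(deriv ^^ k) g field_differentiable (at x)" if "k < n" "x \<in> I" for k x
    using field_differentiable_cong_open[OF assms(1) eq that(2)] assms(3) that
    by (auto simp: Cn_on_def)
  moreover have "continuous_on I ((deriv ^^ n) g)"
    using assms(3) eq by (auto simp: Cn_on_def cong: continuous_on_cong)
  ultimately show ?thesis by (auto simp: Cn_on_def)
qed

text \<open>
  Smoothness of a linear combination and the formula for its \<open>n\<close>-th derivative are proved together,
  since the smoothness of the summands is what legitimates every differentiation.
\<close>

lemma linear_combination_Cn_on:
  fixes f :: "'i \<Rightarrow> real \<Rightarrow> real"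
  assumes "open I" and "\<And>i. i \<in> A \<Longrightarrow> f i \<in> Cn_on n I"
  shows "(\<lambda>x. \<Sum>i\<in>A. c i * f i x) \<in> Cn_on n I \<and>
    (\<forall>x\<in>I. (deriv ^^ n) (\<lambda>x. \<Sum>i\<in>A. c i * f i x) x = (\<Sum>i\<in>A. c i * (deriv ^^ n) (f i) x))"
  using assms(2)
proof (induction n arbitrary: f)
  case 0
  then show ?case by (auto simp: Cn_on_0 intro!: continuous_intros)
next
  case (Suc n)
  let ?F = "\<lambda>x. \<Sum>i\<in>A. c i * f i x" and ?G = "\<lambda>x. \<Sum>i\<in>A. c i * deriv (f i) x"
  have der: "(?F has_field_derivative ?G x) (at x)" if "x \<in> I" for x
    using Suc.prems that
    by (auto simp: Cn_on_Suc field_differentiable_derivI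
        intro!: DERIV_sum DERIV_cmult)
  have eq: "?G x = deriv ?F x" if "x \<in> I" for x
    using der[OF that] by (rule DERIV_imp_deriv[symmetric])
  have IH: "?G \<in> Cn_on n I"
    "\<forall>x\<in>I. (deriv ^^ n) ?G x = (\<Sum>i\<in>A. c i * (deriv ^^ n) (deriv (f i)) x)"
    using Suc.IH[of "\<lambda>i. deriv (f i)"] Suc.prems by (auto simp: Cn_on_Suc)
  have "deriv ?F \<in> Cn_on n I"
    using assms(1) eq IH(1) by (rule Cn_on_cong)
  moreover have "(deriv ^^ n) (deriv ?F) x = (\<Sum>i\<in>A. c i * (deriv ^^ n) (deriv (f i)) x)"
    if "x \<in> I" for x
    using funpow_deriv_cong_open[OF assms(1), of ?G "deriv ?F" x n] eq IH(2) that by simp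
  ultimately show ?case
    using der by (auto simp: Cn_on_Suc funpow_Suc_right field_differentiable_def
        simp del: funpow.simps)
qed

lemmas Cn_on_linear_combination = linear_combination_Cn_on[THEN conjunct1]
lemmas funpow_deriv_linear_combination =
  linear_combination_Cn_on[THEN conjunct2, rule_format]

lemma Cn_on_add:
  assumes "open I" "f \<in> Cn_on n I" "g \<in> Cn_on n I"
  shows "(\<lambda>x. f x + g x) \<in> Cn_on n I"
  using Cn_on_linear_combination[OF assms(1), of UNIV "\<lambda>i. if i then f else g" n "\<lambda>_. 1"] assms
  by (simp add: UNIV_bool add.commute)

lemma Cn_on_mult:
  assumes "open I" "f \<in> Cn_on n I" "g \<in> Cn_on n I"
  shows "(\<lambda>x. f x * g x) \<in> Cn_on n I"
  using assms(2,3)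
proof (induction n arbitrary: f g)
  case 0
  then show ?case by (auto simp: Cn_on_0 intro!: continuous_intros)
next
  case (Suc n)
  have der: "((\<lambda>x. f x * g x) has_field_derivative deriv f x * g x + f x * deriv g x) (at x)"
    if "x \<in> I" for x
    using Suc.prems that DERIV_mult[of f "deriv f x" x UNIV g "deriv g x"]
    by (simp add: Cn_on_Suc field_differentiable_derivI ac_simps)
  have eq: "deriv f x * g x + f x * deriv g x = deriv (\<lambda>x. f x * g x) x" if "x \<in> I" for x
    using der[OF that] by (rule DERIV_imp_deriv[symmetric])
  have "(\<lambda>x. deriv f x * g x + f x * deriv g x) \<in> Cn_on n I"
    using Suc by (intro Cn_on_add assms(1) Suc.IH) (auto simp: Cn_on_Suc intro: Cn_on_Suc_imp_Cn_on)
  then have "deriv (\<lambda>x. f x * g x) \<in> Cn_on n I"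
    using assms(1) eq by (rule Cn_on_cong[rotated 2])
  then show ?case using der by (auto simp: Cn_on_Suc field_differentiable_def)
qed

section \<open>The inverse Leibniz formula\<close>

text \<open>
  In the inverse Leibniz formula \<open>k = s - n\<close> derivatives are spent on \<open>f\<close>; the \<open>n\<close> orders of
  smoothness that are left pay for the \<open>n\<close> outer derivatives.
\<close>

lemma funpow_deriv_mult_Cn_on:
  assumes "open I" "f \<in> Cn_on (k + n) I" "u \<in> Cn_on n I"
  shows "(\<lambda>x. (deriv ^^ k) f x * u x) \<in> Cn_on n I"
  using assms by (intro Cn_on_mult funpow_deriv_Cn_on)

text \<open>
  This is \<open>(E - 1)\<^bsup>s+1\<^esup> = E (E - 1)\<^bsup>s\<^esup> - (E - 1)\<^bsup>s\<^esup>\<close> for the shift \<open>E\<close> of a sequence. Below, \<open>X n\<close> is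
  the \<open>n\<close>-th derivative of \<open>f\<^bsup>(s+1-n)\<^esup> u\<close>, so that the shift trades a derivative of the
  symbol for one of the product.
\<close>

lemma alternating_binomial_sum_Suc:
  fixes X :: "nat \<Rightarrow> real"
  shows "(\<Sum>n=0..Suc s. (-1) ^ (Suc s - n) * real (Suc s choose n) * X n) =
    (\<Sum>n=0..s. (-1) ^ (s - n) * real (s choose n) * X (Suc n)) -
    (\<Sum>n=0..s. (-1) ^ (s - n) * real (s choose n) * X n)"
proof -
  let ?t = "\<lambda>n. (-1) ^ (Suc s - n) * real (s choose n) * X n"
  have "(\<Sum>n=0..Suc s. (-1) ^ (Suc s - n) * real (Suc s choose n) * X n) =
    ?t 0 + (\<Sum>n=0..s. (-1) ^ (s - n) * real (s choose n) * X (Suc n) + ?t (Suc n))"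
    by (subst sum.atLeast0_atMost_Suc_shift) (simp add: algebra_simps)
  also have "\<dots> = (\<Sum>n=0..s. (-1) ^ (s - n) * real (s choose n) * X (Suc n)) + (\<Sum>n=0..Suc s. ?t n)"
    unfolding sum.distrib sum.atLeast0_atMost_Suc_shift[of ?t] o_def diff_Suc_Suc by (rule add.left_commute)
  also have "(\<Sum>n=0..Suc s. ?t n) = (\<Sum>n=0..s. ?t n)"
    by simp
  also have "\<dots> = - (\<Sum>n=0..s. (-1) ^ (s - n) * real (s choose n) * X n)"
    unfolding sum_negf[symmetric] by (intro sum.cong) (auto simp: Suc_diff_le)
  finally show ?thesis by simp
qed

text \<open>
  In the induction step the two parts of Pascal's rule are the formula for \<open>f'\<close> and \<open>u\<close>, that is
  \<open>f' u\<^bsup>(s)\<^esup>\<close>, and the derivative of the formula for \<open>f\<close> and \<open>u\<close>, that is \<open>(f u\<^bsup>(s)\<^esup>)'\<close>. By the product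
  rule their difference is \<open>f u\<^bsup>(s+1)\<^esup>\<close>.
\<close>

lemma inverse_Leibniz:
  assumes "open I" "f \<in> Cn_on s I" "u \<in> Cn_on s I" "x \<in> I"
  shows "(\<Sum>n=0..s. (-1) ^ (s - n) * real (s choose n) *
           (deriv ^^ n) (\<lambda>t. (deriv ^^ (s - n)) f t * u t) x) = f x * (deriv ^^ s) u x"
  using assms(2-4)
proof (induction s arbitrary: f x)
  case 0
  then show ?case by simp
next
  case (Suc s)
  let ?c = "\<lambda>n. (-1) ^ (s - n) * real (s choose n)"
  let ?Y = "\<lambda>n. (deriv ^^ n) (\<lambda>t. (deriv ^^ (s - n)) f t * u t)"
  have f: "f \<in> Cn_on s I" "deriv f \<in> Cn_on s I" "f field_differentiable (at x)"
    and u: "u \<in> Cn_on s I"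
    using Suc.prems Cn_on_Suc_imp_Cn_on by (auto simp: Cn_on_Suc)
  have du: "(deriv ^^ s) u field_differentiable (at x)"
    using Suc.prems by (simp add: Cn_on_def)
  have "(\<Sum>n=0..s. ?c n * (deriv ^^ n) (\<lambda>t. (deriv ^^ (Suc s - n)) f t * u t) x) =
    (\<Sum>n=0..s. ?c n * (deriv ^^ n) (\<lambda>t. (deriv ^^ (s - n)) (deriv f) t * u t) x)"
    by (intro sum.cong) (auto simp: Suc_diff_le funpow_Suc_right simp del: funpow.simps)
  also have "\<dots> = deriv f x * (deriv ^^ s) u x"
    using Suc.IH[OF f(2) u Suc.prems(3)] .
  finally have part1: "(\<Sum>n=0..s. ?c n * (deriv ^^ n) (\<lambda>t. (deriv ^^ (Suc s - n)) f t * u t) x) =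
    deriv f x * (deriv ^^ s) u x" .
  \<comment> \<open>The symbol has one derivative to spare, so the formula for \<open>f\<close> and \<open>u\<close> may be
    differentiated term by term.\<close>
  have Y: "?Y n \<in> Cn_on 1 I" if "n \<in> {0..s}" for n
    using Suc.prems that assms(1)
    by (intro funpow_deriv_Cn_on funpow_deriv_mult_Cn_on) (auto intro: Cn_on_antimono)
  have "(\<Sum>n=0..s. ?c n * (deriv ^^ Suc n) (\<lambda>t. (deriv ^^ (s - n)) f t * u t) x) =
    deriv (\<lambda>y. \<Sum>n=0..s. ?c n * ?Y n y) x"
    using funpow_deriv_linear_combination[OF assms(1) _ Suc.prems(3),
        where A = "{0..s}" and f = ?Y and c = ?c and n = 1] Y by simp
  also have "\<dots> = deriv (\<lambda>y. f y * (deriv ^^ s) u y) x"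
    using Suc.IH[OF f(1) u] by (intro deriv_cong_open[OF assms(1) _ Suc.prems(3)])
  also have "\<dots> = f x * (deriv ^^ Suc s) u x + deriv f x * (deriv ^^ s) u x"
    using f(3) du by simp
  finally have part2: "(\<Sum>n=0..s. ?c n * (deriv ^^ Suc n) (\<lambda>t. (deriv ^^ (s - n)) f t * u t) x) =
    f x * (deriv ^^ Suc s) u x + deriv f x * (deriv ^^ s) u x" .
  show ?case
    unfolding alternating_binomial_sum_Suc diff_Suc_Suc part1 part2 by simp
qed

section \<open>Rewriting the differential equation\<close>

theorem theorem2:
  fixes l h :: real and I :: "real set" and N :: nat
    and a b :: "nat \<Rightarrow> real \<Rightarrow> real" and r :: "real \<Rightarrow> real"
  assumes "l < h" and "I = {l<..<h}"
    and "\<And>n. n \<le> N \<Longrightarrow> a n \<in> Cn_on n I"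
    and "b = bcoeff N a"
  shows "\<forall>u \<in> Cn_on N I.
           (\<forall>n\<le>N. (\<lambda>x. b n x * u x) \<in> Cn_on n I) \<and>
           (\<forall>x\<in>I. (\<Sum>n=0..N. a n x * (deriv ^^ n) u x) =
                   (\<Sum>n=0..N. (deriv ^^ n) (\<lambda>t. b n t * u t) x)) \<and>
           ((\<forall>x\<in>I. (\<Sum>n=0..N. a n x * (deriv ^^ n) u x) = r x) \<longleftrightarrow>
            (\<forall>x\<in>I. (\<Sum>n=0..N. (deriv ^^ n) (\<lambda>t. b n t * u t) x) = r x))"
proof
  fix u assume u: "u \<in> Cn_on N I"
  have I: "open I" using assms(2) by simp
  let ?c = "\<lambda>n s. (-1) ^ (s - n) * real (s choose n)"
  let ?g = "\<lambda>n s t. (deriv ^^ (s - n)) (a s) t * u t"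
  have bu: "(\<lambda>t. b n t * u t) = (\<lambda>t. \<Sum>s=n..N. ?c n s * ?g n s t)" for n
    by (simp add: assms(4) bcoeff_def sum_distrib_right mult.assoc)
  have g: "?g n s \<in> Cn_on n I" if "s \<in> {n..N}" for n s
    using that assms(3)[of s] u
    by (intro funpow_deriv_mult_Cn_on I) (auto intro: Cn_on_antimono)
  have smooth: "(\<lambda>t. b n t * u t) \<in> Cn_on n I" for n
    unfolding bu using I g by (rule Cn_on_linear_combination)
  have eq: "(\<Sum>n=0..N. a n x * (deriv ^^ n) u x) = (\<Sum>n=0..N. (deriv ^^ n) (\<lambda>t. b n t * u t) x)"
    if x: "x \<in> I" for x
  proof -
    have upper: "{s. s \<le> N \<and> n \<le> s} = {n..N}" for n by auto
    have lower: "{n. n \<le> N \<and> n \<le> s} = {0..s}" if "s \<le> N" for s using that by auto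
    have "(\<Sum>n=0..N. (deriv ^^ n) (\<lambda>t. b n t * u t) x) =
      (\<Sum>n=0..N. \<Sum>s=n..N. ?c n s * (deriv ^^ n) (?g n s) x)"
      unfolding bu using g by (intro sum.cong refl funpow_deriv_linear_combination[OF I _ x])
    also have "\<dots> = (\<Sum>s=0..N. \<Sum>n=0..s. ?c n s * (deriv ^^ n) (?g n s) x)"
      using sum.swap_restrict[of "{0..N}" "{0..N}" "\<lambda>n s. ?c n s * (deriv ^^ n) (?g n s) x" "(\<le>)"]
      by (simp add: upper lower)
    also have "\<dots> = (\<Sum>s=0..N. a s x * (deriv ^^ s) u x)"
      using assms(3) u x by (intro sum.cong inverse_Leibniz[OF I]) (auto intro: Cn_on_antimono)
    finally show ?thesis by simp
  qed
  show "(\<forall>n\<le>N. (\<lambda>x. b n x * u x) \<in> Cn_on n I) \<and>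
           (\<forall>x\<in>I. (\<Sum>n=0..N. a n x * (deriv ^^ n) u x) =
                   (\<Sum>n=0..N. (deriv ^^ n) (\<lambda>t. b n t * u t) x)) \<and>
           ((\<forall>x\<in>I. (\<Sum>n=0..N. a n x * (deriv ^^ n) u x) = r x) \<longleftrightarrow>
            (\<forall>x\<in>I. (\<Sum>n=0..N. (deriv ^^ n) (\<lambda>t. b n t * u t) x) = r x))"
    using smooth eq by simp
qed

end
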